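(* Let $g:\mathbb{R}^d\to\mathbb{R}^d$ satisfy $\|g(x)\|\le P$ and $\|g(x)-g(z)\|\le L\|x-z\|$ for all $x,z\in\mathbb{R}^d$, and let $\phi:\mathbb{R}\times\mathbb{R}^d\to\mathbb{R}^d$ be the solution map of $\dot x(t)=g(x(t))$. Let $Q\subset\mathbb{R}^d$ be a box and let $M,N\ge1$ be integers. Let $\Omega_n=\{D_i^n:i\in I_n\}$, $n\in\mathbb{N}$, be the dyadic box covers of $Q$ with diameters $\rho_n$, and let $z^{i,n}_0,\ldots,z^{i,n}_{M^d-1}$ and $\varrho_n=\rho_n/M$ be the subbox centers and diameters described in the context. Let $(h_n)_{n=0}^\infty$ be positive step-sizes with $\lim_{n\to\infty}h_n=0$ and $\lim_{n\to\infty}h_n^{-1}\rho_n=0$, and let $\phi_E(-h_n,\cdot)$ denote $N$ backward-in-time Euler steps of size $\theta_n=h_n/N$ (see context). Define $$r_n:=e^{Lh_n}\varrho_n+\tfrac{1}{2N}Ph_n(e^{Lh_n}-1),$$ $$\varphi_n(i):=\Big\{j\in I_n:\ \Big(\bigcup_{l=0}^{M^d-1}\{\phi_E(-h_n,z^{i,n}_l)\}+B_{r_n}(0)\Big)\cap D^n_j\neq\emptyset\Big\},\quad i\in I_n.$$ Then $$\lim_{n\to\infty}\sup_{i\in I_n}\sup_{j\in\varphi_n(i)}\operatorname{dist}(D_j^n,D_i^n)=0,$$ $$\lim_{n\to\infty}\sup_{i\in I_n}\sup_{j\in\varphi_n(i)}\sup_{x\in D^n_j}\sup_{z\in D^n_i}\|h_n^{-1}(x-z)+g(z)\|=0,$$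 and $$\big(\phi(-h_n,D_i^n)\cap Q\big)\subset\bigcup_{j\in\varphi_n(i)}D_j^n\quad\text{for all } i\in I_n,\ n\in\mathbb{N}.$$
   Context: $\mathbb{N}=\{0,1,2,\ldots\}$, $\|\cdot\|$ is a fixed vector norm on $\mathbb{R}^d$, and $B_r(0)=\{x:\|x\|\le r\}$. $\phi(t,x)$ is the value at time $t$ of the unique global solution of $\dot x(t)=g(x(t))$, $x(0)=x$. For $X,Y\subset\mathbb{R}^d$, $\operatorname{diam}(X)=\sup_{x\in X}\sup_{y\in X}\|x-y\|$ and $\operatorname{dist}(X,Y)=\sup_{x\in X}\inf_{y\in Y}\|x-y\|$ (one-sided semidistance); suprema over empty sets are $0$; sums of sets are Minkowski sums. A box is a product of $d$ compact nondegenerate intervals. Construction of the covers: $\rho_0:=\operatorname{diam}(Q)$, $I_0=\{0\}$, $D_0^0=Q$. Given the boxes $D_i^n$, $i\in I_n=\{0,\ldots,2^{nd}-1\}$, each $D_i^n$ is subdivided into $2^d$ congruent subboxes (halving each edge) $D^{n+1}_{i2^d},\ldots,D^{n+1}_{(i+1)2^d-1}$; set $I_{n+1}:=\{0,\ldots,2^{(n+1)d}-1\}$ and $\rho_{n+1}:=\frac12\rho_n$. Further, each $D_i^n$ is decomposed into $M^d$ congruent subboxes $E^{i,n}_0,\ldots,E^{i,n}_{M^d-1}$ (dividing each edge into $M$ equal parts) with centers $z^{i,n}_0,\ldots,z^{i,n}_{M^d-1}$ and diameter $\varrho_n:=\rho_n/M$. Euler scheme: with $\theta_n:=h_n/N$,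 put $\phi_E(0,x):=x$ and $\phi_E(-(k+1)\theta_n,x):=\phi_E(-k\theta_n,x)-\theta_n\,g(\phi_E(-k\theta_n,x))$ for $k=0,\ldots,N-1$; thus $\phi_E(-h_n,x)$ is the result after $N$ steps. *)

theory Defs
  imports "HOL-Analysis.Analysis"
begin

definition vector_norm :: "(real^'d \<Rightarrow> real) \<Rightarrow> bool" where
  "vector_norm nrm \<longleftrightarrow>
     (\<forall>x. 0 \<le> nrm x) \<and> (\<forall>x. nrm x = 0 \<longleftrightarrow> x = 0) \<and>
     (\<forall>c x. nrm (c *\<^sub>R x) = \<bar>c\<bar> * nrm x) \<and>
     (\<forall>x y. nrm (x + y) \<le> nrm x + nrm y)"

definition norm_ball0 :: "(real^'d \<Rightarrow> real) \<Rightarrow> real \<Rightarrow> (real^'d) set" where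
  "norm_ball0 nrm r = {x. nrm x \<le> r}"

text \<open>Suprema are taken in \<^typ>\<open>ennreal\<close>, where the supremum of the empty set is 0 and
  unbounded sets have supremum infinity.\<close>

definition norm_diam :: "(real^'d \<Rightarrow> real) \<Rightarrow> (real^'d) set \<Rightarrow> ennreal" where
  "norm_diam nrm X = (SUP x\<in>X. SUP y\<in>X. ennreal (nrm (x - y)))"

definition norm_semidist :: "(real^'d \<Rightarrow> real) \<Rightarrow> (real^'d) set \<Rightarrow> (real^'d) set \<Rightarrow> ennreal" where
  "norm_semidist nrm X Y = (SUP x\<in>X. INF y\<in>Y. ennreal (nrm (x - y)))"

text \<open>Uniqueness of the solutions is not part of the definition: it follows from the
  Lipschitz continuity of the right-hand side.\<close>

definition solution_map :: "(real^'d \<Rightarrow> real^'d) \<Rightarrow> (real \<Rightarrow> real^'d \<Rightarrow> real^'d) \<Rightarrow> bool" where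
  "solution_map g \<phi> \<longleftrightarrow>
     (\<forall>x. \<phi> 0 x = x \<and>
          (\<forall>t. ((\<lambda>s. \<phi> s x) has_vector_derivative g (\<phi> t x)) (at t)))"

definition is_box :: "(real^'d) set \<Rightarrow> bool" where
  "is_box X \<longleftrightarrow> (\<exists>a b. (\<forall>k. a $ k < b $ k) \<and> X = cbox a b)"

definition box_center :: "(real^'d) set \<Rightarrow> real^'d" where
  "box_center X = midpoint (interval_lowerbound X) (interval_upperbound X)"

text \<open>The \<open>m ^ d\<close> congruent subboxes obtained by dividing each edge of a box into \<open>m\<close> equal
  parts; \<open>e\<close> selects one of the \<open>m\<close> parts in each coordinate.\<close>

definition subboxes :: "nat \<Rightarrow> (real^'d) set \<Rightarrow> (real^'d) set set" where
  "subboxes m X =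
     (let a = interval_lowerbound X; b = interval_upperbound X in
      {cbox (\<chi> k. a $ k + real (e k) / real m * (b $ k - a $ k))
            (\<chi> k. a $ k + real (e k + 1) / real m * (b $ k - a $ k))
       | e :: 'd \<Rightarrow> nat. \<forall>k. e k < m})"

definition cover_index :: "nat \<Rightarrow> nat \<Rightarrow> nat set" where
  "cover_index d n = {..<2 ^ (n * d)}"

text \<open>\<open>D n i\<close> is the \<open>i\<close>-th box of level \<open>n\<close>. The \<open>2 ^ d\<close> subboxes of a box may be numbered
  in any order.\<close>

definition dyadic_covers :: "(real^'d) set \<Rightarrow> (nat \<Rightarrow> nat \<Rightarrow> (real^'d) set) \<Rightarrow> bool" where
  "dyadic_covers Q D \<longleftrightarrow>
     D 0 0 = Q \<and>
     (\<forall>n. \<forall>i\<in>cover_index CARD('d) n.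
        bij_betw (\<lambda>l. D (Suc n) (i * 2 ^ CARD('d) + l)) {..<2 ^ CARD('d)} (subboxes 2 (D n i)))"

definition box_decompositions ::
    "nat \<Rightarrow> (nat \<Rightarrow> nat \<Rightarrow> (real^'d) set) \<Rightarrow> (nat \<Rightarrow> nat \<Rightarrow> nat \<Rightarrow> (real^'d) set) \<Rightarrow> bool" where
  "box_decompositions M D E \<longleftrightarrow>
     (\<forall>n. \<forall>i\<in>cover_index CARD('d) n.
        bij_betw (E n i) {..<M ^ CARD('d)} (subboxes M (D n i)))"

primrec cover_diam :: "(real^'d \<Rightarrow> real) \<Rightarrow> (real^'d) set \<Rightarrow> nat \<Rightarrow> real" where
  "cover_diam nrm Q 0 = enn2real (norm_diam nrm Q)"
| "cover_diam nrm Q (Suc n) = cover_diam nrm Q n / 2"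

text \<open>\<open>euler_backward g \<theta> k x\<close> is the value at time \<open>- k \<theta>\<close> of the Euler scheme started at \<open>x\<close>.\<close>

primrec euler_backward :: "(real^'d \<Rightarrow> real^'d) \<Rightarrow> real \<Rightarrow> nat \<Rightarrow> real^'d \<Rightarrow> real^'d" where
  "euler_backward g \<theta> 0 x = x"
| "euler_backward g \<theta> (Suc k) x =
     euler_backward g \<theta> k x - \<theta> *\<^sub>R g (euler_backward g \<theta> k x)"

end

theory Submission
  imports Defs
begin

text \<open>A differentiable curve moves by at most the integral of the norm of its velocity, for an
  arbitrary norm; hence the local error of an Euler step of size \<open>\<theta>\<close> is at most \<open>L P \<theta>\<^sup>2 / 2\<close>, and
  the discrete Gronwall argument yields exactly the radius \<open>r n\<close> for all starting points in a
  subbox. So each point of \<open>\<phi> (- h n) ` D n i \<inter> Q\<close> lies in a box meeting the inflated Euler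
  images. Conversely, a box selected from \<open>D n i\<close> contains a point within \<open>r n\<close> of an Euler image
  \<open>e\<close> of a point \<open>\<zeta> \<in> D n i\<close>, and \<open>e - \<zeta> + h n *\<^sub>R g \<zeta>\<close> is \<open>O((h n)\<^sup>2)\<close>, so that both limits
  follow from \<open>\<rho> n = o(h n)\<close> and \<open>r n = o(h n)\<close>.\<close>

section \<open>Mean value estimates in an arbitrary norm\<close>

text \<open>If the difference quotient lay outside \<open>S\<close>, a hyperplane with normal
  \<open>v\<close> would separate it strictly from \<open>S\<close>. The scalar mean value theorem
  for \<open>inner v (f t)\<close> then produces a derivative \<open>f' t\<close> on the wrong side
  of that hyperplane.\<close>

lemma mean_value_in_closed_convex:
  fixes f :: "real \<Rightarrow> 'a::euclidean_space"
  assumes S: "closed S" "convex S" and "a < b"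
    and deriv: "\<And>t. t \<in> {a..b} \<Longrightarrow> (f has_vector_derivative f' t) (at t within {a..b})"
    and mem: "\<And>t. t \<in> {a..b} \<Longrightarrow> f' t \<in> S"
  shows "(1 / (b - a)) *\<^sub>R (f b - f a) \<in> S"
proof (rule ccontr)
  assume "(1 / (b - a)) *\<^sub>R (f b - f a) \<notin> S"
  with S obtain v \<beta> where v: "inner v ((1 / (b - a)) *\<^sub>R (f b - f a)) < \<beta>"
      "\<And>x. x \<in> S \<Longrightarrow> \<beta> < inner v x"
    by (meson separating_hyperplane_closed_point)
  have "((\<lambda>t. inner v (f t)) has_derivative (\<lambda>s. s * inner v (f' t))) (at t within {a..b})"
    if "a \<le> t" "t \<le> b" for t
    using deriv[of t] that
    by (auto simp: has_vector_derivative_def intro!: derivative_eq_intros)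
  from mvt_very_simple[of a b, OF less_imp_le[OF \<open>a < b\<close>] this]
  obtain t where t: "t \<in> {a..b}"
    "inner v (f b) - inner v (f a) = (b - a) * inner v (f' t)"
    by blast
  have "inner v ((1 / (b - a)) *\<^sub>R (f b - f a)) = inner v (f' t)"
    using t \<open>a < b\<close> by (simp add: inner_diff_right)
  then show False
    using v mem[OF t(1)] by fastforce
qed

context
  fixes nrm :: "real^'d \<Rightarrow> real"
  assumes nrm: "vector_norm nrm"
begin

lemma vector_norm_nonneg: "0 \<le> nrm x"
  and vector_norm_zero: "nrm 0 = 0"
  and vector_norm_scaleR: "nrm (c *\<^sub>R x) = \<bar>c\<bar> * nrm x"
  and vector_norm_triangle: "nrm (x + y) \<le> nrm x + nrm y"
  using nrm by (simp_all add: vector_norm_def)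

lemma vector_norm_triangle3: "nrm (x + y + z) \<le> nrm x + nrm y + nrm z"
  using vector_norm_triangle[of "x + y" z] vector_norm_triangle[of x y] by linarith

lemma vector_norm_triangle4: "nrm (w + x + y + z) \<le> nrm w + nrm x + nrm y + nrm z"
  using vector_norm_triangle[of "w + x + y" z] vector_norm_triangle3[of w x y] by linarith

text \<open>Homogeneity and the triangle inequality make \<open>nrm\<close> convex, and a
  real-valued convex function on a finite-dimensional space is continuous. This is the link between
  the abstract norm and the Euclidean topology.\<close>

lemma continuous_on_vector_norm: "continuous_on UNIV nrm"
proof (rule convex_on_continuous)
  show "convex_on UNIV nrm"
    by (rule convex_onI, rule order_trans[OF vector_norm_triangle])
      (auto simp: vector_norm_scaleR)
qed simp

lemma vector_norm_diff_bounded: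
  assumes "bounded X"
  shows "\<exists>B. \<forall>x\<in>X. \<forall>y\<in>X. nrm (x - y) \<le> B"
proof -
  have "compact (nrm ` closure ((\<lambda>(x, y). x - y) ` (X \<times> X)))"
    by (intro compact_continuous_image continuous_on_subset[OF continuous_on_vector_norm])
      (use bounded_minus[OF assms assms] in
        \<open>auto simp: compact_closure case_prod_unfold image_def Bex_def\<close>)
  then have "bdd_above (nrm ` closure ((\<lambda>(x, y). x - y) ` (X \<times> X)))"
    by (intro bounded_imp_bdd_above compact_imp_bounded)
  then obtain B where "\<forall>w\<in>closure ((\<lambda>(x, y). x - y) ` (X \<times> X)). nrm w \<le> B"
    by (auto simp: bdd_above_def)
  then show ?thesis
    using closure_subset[of "(\<lambda>(x, y). x - y) ` (X \<times> X)"] by fastforce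
qed

text \<open>Since \<open>enn2real\<close> maps infinity to 0, the estimate hinges on
  \<open>norm_diam nrm X\<close> being finite; boundedness of \<open>X\<close> supplies that through
  the uniform bound \<open>B\<close>.\<close>

lemma vector_norm_diff_le_diam:
  assumes "bounded X" "x \<in> X" "y \<in> X"
  shows "nrm (x - y) \<le> enn2real (norm_diam nrm X)"
proof -
  obtain B where B: "\<forall>x\<in>X. \<forall>y\<in>X. nrm (x - y) \<le> B"
    using vector_norm_diff_bounded[OF assms(1)] by blast
  have "norm_diam nrm X \<le> ennreal B"
    unfolding norm_diam_def using B by (intro SUP_least) (auto intro: ennreal_leI)
  then have "norm_diam nrm X < top"
    by (simp add: le_less_trans)
  moreover have "ennreal (nrm (x - y)) \<le> norm_diam nrm X"
    unfolding norm_diam_def using assms(2,3) by (meson SUP_upper2 order_refl)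
  ultimately show ?thesis
    using enn2real_mono vector_norm_nonneg by (metis enn2real_ennreal)
qed

text \<open>The pair of \<open>f\<close> and \<open>\<beta>\<close> has its derivative in the epigraph of the norm, which is a closed
  convex cone.\<close>

lemma vector_norm_increment_le:
  fixes f :: "real \<Rightarrow> real^'d"
  assumes "a \<le> b"
    and f: "\<And>t. t \<in> {a..b} \<Longrightarrow> (f has_vector_derivative f' t) (at t within {a..b})"
    and \<beta>: "\<And>t. t \<in> {a..b} \<Longrightarrow> (\<beta> has_vector_derivative \<beta>' t) (at t within {a..b})"
    and le: "\<And>t. t \<in> {a..b} \<Longrightarrow> nrm (f' t) \<le> \<beta>' t"
  shows "nrm (f b - f a) \<le> \<beta> b - \<beta> a"
proof (cases "a = b")
  case False
  then have "a < b" using assms(1) by simp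
  define S where "S = {p. nrm (fst p) \<le> snd p}"
  have "continuous_on UNIV (\<lambda>p::(real^'d) \<times> real. nrm (fst p))"
    by (rule continuous_on_compose2[OF continuous_on_vector_norm]) (auto intro: continuous_intros)
  then have "closed S"
    unfolding S_def by (intro closed_Collect_le continuous_intros) auto
  have "convex S"
  proof (rule convexI)
    fix p q :: "(real^'d) \<times> real" and u v :: real
    assume "p \<in> S" "q \<in> S" "0 \<le> u" "0 \<le> v" "u + v = 1"
    then have "nrm (u *\<^sub>R fst p + v *\<^sub>R fst q) \<le> u * nrm (fst p) + v * nrm (fst q)"
      using vector_norm_triangle[of "u *\<^sub>R fst p" "v *\<^sub>R fst q"] by (simp add: vector_norm_scaleR)
    also have "\<dots> \<le> u * snd p + v * snd q"
      using \<open>p \<in> S\<close> \<open>q \<in> S\<close> \<open>0 \<le> u\<close> \<open>0 \<le> v\<close> by (intro add_mono mult_left_mono) (auto simp: S_def)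
    finally show "u *\<^sub>R p + v *\<^sub>R q \<in> S" by (simp add: S_def)
  qed
  have "(1 / (b - a)) *\<^sub>R ((f b, \<beta> b) - (f a, \<beta> a)) \<in> S"
    by (rule mean_value_in_closed_convex[OF \<open>closed S\<close> \<open>convex S\<close> \<open>a < b\<close>,
          where f' = "\<lambda>t. (f' t, \<beta>' t)" and f = "\<lambda>t. (f t, \<beta> t)"])
      (use f \<beta> le in \<open>auto simp: S_def intro: has_vector_derivative_Pair\<close>)
  then have "(1 / (b - a)) * nrm (f b - f a) \<le> (1 / (b - a)) * (\<beta> b - \<beta> a)"
    using \<open>a < b\<close> by (simp add: S_def vector_norm_scaleR)
  then show ?thesis
    using \<open>a < b\<close> by (simp add: divide_le_cancel)
qed (simp add: vector_norm_zero)

lemma solution_map_increment_le: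
  assumes "solution_map g \<phi>" "\<forall>x. nrm (g x) \<le> P" "0 \<le> s"
  shows "nrm (\<phi> t x - \<phi> (t - s) x) \<le> P * s"
proof -
  have "nrm (\<phi> t x - \<phi> (t - s) x) \<le> P * t - P * (t - s)"
  proof (rule vector_norm_increment_le)
    show "((\<lambda>u. \<phi> u x) has_vector_derivative g (\<phi> u x)) (at u within {t - s..t})" for u
      using assms(1) by (auto simp: solution_map_def intro: has_vector_derivative_at_within)
    show "((\<lambda>u. P * u) has_vector_derivative P) (at u within {t - s..t})" for u
      by (auto intro!: derivative_eq_intros)
  qed (use assms in auto)
  then show ?thesis by (simp add: algebra_simps)
qed

section \<open>Error estimates for the Euler scheme\<close>

context
  fixes g :: "real^'d \<Rightarrow> real^'d" and P L :: real
  assumes bound: "\<forall>x. nrm (g x) \<le> P"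
    and lipschitz: "\<forall>x y. nrm (g x - g y) \<le> L * nrm (x - y)"
begin

lemma bound_nonneg: "0 \<le> P"
  using bound vector_norm_nonneg order_trans by blast

text \<open>The space has at least one coordinate, so \<open>1\<close> and \<open>0\<close> are
  distinct points at which the Lipschitz estimate forces the sign of \<open>L\<close>.\<close>

lemma lipschitz_constant_nonneg: "0 \<le> L"
proof -
  have "nrm (1 - 0) \<noteq> 0"
    using nrm by (simp add: vector_norm_def)
  moreover have "0 \<le> L * nrm (1 - 0)"
    using lipschitz vector_norm_nonneg order_trans by blast
  ultimately show ?thesis
    using vector_norm_nonneg[of "1 - 0"] by (simp add: zero_le_mult_iff)
qed

text \<open>The curve \<open>?c\<close> is the exact solution run backwards minus the linear motion
  of the Euler step. Its velocity at \<open>s\<close> is a difference of two values of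
  \<open>g\<close> along the trajectory, hence of norm at most \<open>L * (P * s)\<close>, and
  integrating this over the step gives the factor one half.\<close>

lemma euler_step_error:
  assumes "solution_map g \<phi>" "0 \<le> \<theta>"
  shows "nrm (\<phi> (t - \<theta>) x - (\<phi> t x - \<theta> *\<^sub>R g (\<phi> t x))) \<le> L * P * \<theta>\<^sup>2 / 2"
proof -
  let ?c = "\<lambda>s. \<phi> (t - s) x + s *\<^sub>R g (\<phi> t x)"
  have "nrm (?c \<theta> - ?c 0) \<le> L * P * \<theta>\<^sup>2 / 2 - L * P * 0\<^sup>2 / 2"
  proof (rule vector_norm_increment_le)
    fix s assume s: "s \<in> {0..\<theta>}"
    have neg: "((\<lambda>s. t - s) has_vector_derivative - 1) (at s)"
      unfolding has_real_derivative_iff_has_vector_derivative[symmetric]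
      by (auto intro!: derivative_eq_intros)
    have "((\<lambda>u. \<phi> u x) has_vector_derivative g (\<phi> (t - s) x)) (at (t - s))"
      using assms(1) by (simp add: solution_map_def)
    then have "((\<lambda>s. \<phi> (t - s) x) has_vector_derivative - g (\<phi> (t - s) x)) (at s)"
      using vector_diff_chain_at[OF neg, of "\<lambda>u. \<phi> u x"] by (simp add: o_def)
    then have "(?c has_vector_derivative - g (\<phi> (t - s) x) + g (\<phi> t x)) (at s)"
      by (auto intro!: derivative_eq_intros)
    then show "(?c has_vector_derivative g (\<phi> t x) - g (\<phi> (t - s) x)) (at s within {0..\<theta>})"
      by (simp add: has_vector_derivative_at_within)
    show "((\<lambda>s. L * P * s\<^sup>2 / 2) has_vector_derivative L * (P * s)) (at s within {0..\<theta>})"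
      unfolding has_real_derivative_iff_has_vector_derivative[symmetric]
      by (auto intro!: derivative_eq_intros)
    have "nrm (g (\<phi> t x) - g (\<phi> (t - s) x)) \<le> L * nrm (\<phi> t x - \<phi> (t - s) x)"
      using lipschitz by blast
    also have "\<dots> \<le> L * (P * s)"
      using s solution_map_increment_le[OF assms(1) bound, of s] lipschitz_constant_nonneg
      by (intro mult_left_mono) auto
    finally show "nrm (g (\<phi> t x) - g (\<phi> (t - s) x)) \<le> L * (P * s)" .
  qed (use assms in auto)
  then show ?thesis by (simp add: algebra_simps)
qed

text \<open>Discrete Gronwall: each step multiplies the error by at most
  \<open>1 + L * \<theta>\<close> and adds the local error. The geometric sum of the local errors is
  written without dividing by \<open>L\<close>, so that \<open>L = 0\<close> is covered.\<close>

lemma euler_backward_error: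
  assumes "solution_map g \<phi>" "0 \<le> \<theta>"
  shows "nrm (\<phi> (- (real k * \<theta>)) x - euler_backward g \<theta> k y)
           \<le> (1 + L * \<theta>) ^ k * nrm (x - y) + P * \<theta> / 2 * ((1 + L * \<theta>) ^ k - 1)"
proof (induction k)
  case 0
  show ?case using assms by (simp add: solution_map_def)
next
  case (Suc k)
  let ?u = "\<phi> (- (real k * \<theta>)) x" and ?w = "euler_backward g \<theta> k y"
  let ?u' = "\<phi> (- (real k * \<theta>) - \<theta>) x"
  have "- (real (Suc k) * \<theta>) = - (real k * \<theta>) - \<theta>"
    by (simp add: algebra_simps)
  then have "\<phi> (- (real (Suc k) * \<theta>)) x - euler_backward g \<theta> (Suc k) y
      = (?u' - (?u - \<theta> *\<^sub>R g ?u)) + (?u - ?w) + (- \<theta>) *\<^sub>R (g ?u - g ?w)"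
    by (simp only: euler_backward.simps) (simp add: algebra_simps)
  also have "nrm \<dots> \<le> nrm (?u' - (?u - \<theta> *\<^sub>R g ?u)) + nrm (?u - ?w) + nrm ((- \<theta>) *\<^sub>R (g ?u - g ?w))"
    by (rule vector_norm_triangle3)
  also have "\<dots> \<le> L * P * \<theta>\<^sup>2 / 2 + nrm (?u - ?w) + \<theta> * (L * nrm (?u - ?w))"
    using euler_step_error[OF assms, of "- (real k * \<theta>)" x] assms(2)
      mult_left_mono[OF lipschitz[rule_format], of \<theta> ?u ?w]
    unfolding vector_norm_scaleR by simp
  also have "\<dots> = (1 + L * \<theta>) * nrm (?u - ?w) + L * P * \<theta>\<^sup>2 / 2"
    by (simp add: algebra_simps)
  also have "\<dots> \<le> (1 + L * \<theta>) * ((1 + L * \<theta>) ^ k * nrm (x - y) + P * \<theta> / 2 * ((1 + L * \<theta>) ^ k - 1))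
      + L * P * \<theta>\<^sup>2 / 2"
    using mult_left_mono[OF Suc, of "1 + L * \<theta>"] lipschitz_constant_nonneg assms(2) by simp
  \<comment> \<open>The local error equals
    \<open>P * \<theta> / 2 * ((1 + L * \<theta>) - 1)\<close>, so the second summand
    telescopes.\<close>
  also have "\<dots> = (1 + L * \<theta>) ^ Suc k * nrm (x - y) + P * \<theta> / 2 * ((1 + L * \<theta>) ^ Suc k - 1)"
    by (simp add: field_simps power2_eq_square)
  finally show ?case .
qed

text \<open>The growth factor of \<open>N\<close> steps is at most \<open>exp (L * h)\<close>. With
  \<open>nrm (x - y)\<close> bounded by the subbox diameter, the right-hand side becomes the
  inflation radius \<open>r n\<close>.\<close>

lemma euler_backward_error_exp:
  assumes "solution_map g \<phi>" "0 \<le> h" "N \<ge> 1"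
  shows "nrm (\<phi> (- h) x - euler_backward g (h / real N) N y)
           \<le> exp (L * h) * nrm (x - y) + 1 / (2 * real N) * P * h * (exp (L * h) - 1)"
proof -
  let ?\<theta> = "h / real N"
  have N: "real N * ?\<theta> = h" using assms(3) by simp
  have "(1 + L * ?\<theta>) ^ N \<le> exp (L * ?\<theta>) ^ N"
    using lipschitz_constant_nonneg assms(2) by (intro power_mono exp_ge_add_one_self) auto
  also have "\<dots> = exp (L * h)"
    using N by (metis exp_of_nat_mult mult.left_commute)
  finally have le: "(1 + L * ?\<theta>) ^ N \<le> exp (L * h)" .
  have "nrm (\<phi> (- h) x - euler_backward g ?\<theta> N y)
      \<le> (1 + L * ?\<theta>) ^ N * nrm (x - y) + P * ?\<theta> / 2 * ((1 + L * ?\<theta>) ^ N - 1)"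
    using euler_backward_error[OF assms(1), of ?\<theta> N x y] assms(2) unfolding N by simp
  also have "\<dots> \<le> exp (L * h) * nrm (x - y) + P * ?\<theta> / 2 * (exp (L * h) - 1)"
    using le bound_nonneg assms(2)
    by (intro add_mono mult_right_mono mult_left_mono) (auto simp: vector_norm_nonneg)
  finally show ?thesis by (simp add: field_simps)
qed

lemma euler_backward_displacement_le:
  assumes "0 \<le> \<theta>"
  shows "nrm (euler_backward g \<theta> k x - x) \<le> P * (real k * \<theta>)"
proof (induction k)
  case (Suc k)
  let ?w = "euler_backward g \<theta> k x"
  have "nrm (euler_backward g \<theta> (Suc k) x - x) = nrm ((?w - x) + (- \<theta>) *\<^sub>R g ?w)"
    by (simp add: algebra_simps)
  also have "\<dots> \<le> nrm (?w - x) + \<theta> * nrm (g ?w)"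
    using vector_norm_triangle[of "?w - x" "(- \<theta>) *\<^sub>R g ?w"] assms
    unfolding vector_norm_scaleR by simp
  also have "\<dots> \<le> P * (real k * \<theta>) + \<theta> * P"
    using Suc bound assms by (intro add_mono mult_left_mono) auto
  finally show ?case by (simp add: algebra_simps)
qed (simp add: vector_norm_zero)

text \<open>After \<open>k\<close> steps the point has moved by at most
  \<open>P * (real k * \<theta>)\<close>, so the next velocity differs from \<open>g x\<close> by at
  most \<open>L\<close> times that. Summing over the steps gives second order in the total time; the
  constant is rounded up to keep the induction simple.\<close>

lemma euler_backward_consistency:
  assumes "0 \<le> \<theta>"
  shows "nrm (euler_backward g \<theta> k x - x + (real k * \<theta>) *\<^sub>R g x) \<le> L * P * (real k * \<theta>)\<^sup>2"
proof (induction k)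
  case (Suc k)
  let ?w = "euler_backward g \<theta> k x"
  have "nrm (euler_backward g \<theta> (Suc k) x - x + (real (Suc k) * \<theta>) *\<^sub>R g x)
      = nrm ((?w - x + (real k * \<theta>) *\<^sub>R g x) + (- \<theta>) *\<^sub>R (g ?w - g x))"
    by (simp add: algebra_simps)
  also have "\<dots> \<le> nrm (?w - x + (real k * \<theta>) *\<^sub>R g x) + \<theta> * nrm (g ?w - g x)"
    using vector_norm_triangle[of "?w - x + (real k * \<theta>) *\<^sub>R g x" "(- \<theta>) *\<^sub>R (g ?w - g x)"] assms
    unfolding vector_norm_scaleR by simp
  also have "\<dots> \<le> L * P * (real k * \<theta>)\<^sup>2 + \<theta> * (L * (P * (real k * \<theta>)))"
    using Suc assms lipschitz_constant_nonneg
    by (intro add_mono mult_left_mono order_trans[OF lipschitz[rule_format]]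
        euler_backward_displacement_le) auto
  also have "\<dots> = L * P * \<theta>\<^sup>2 * ((real k)\<^sup>2 + real k)"
    by (simp add: algebra_simps power2_eq_square)
  also have "\<dots> \<le> L * P * \<theta>\<^sup>2 * (real (Suc k))\<^sup>2"
    using lipschitz_constant_nonneg bound_nonneg
    by (intro mult_left_mono) (auto simp: power2_eq_square algebra_simps)
  finally show ?case by (simp add: power_mult_distrib mult_ac)
qed (simp add: vector_norm_zero)

end

end

section \<open>Geometry of boxes and dyadic covers\<close>

lemma interval_bounds_cart:
  fixes a b :: "real^'d"
  assumes "\<forall>k. a $ k \<le> b $ k"
  shows "interval_lowerbound (cbox a b) = a" "interval_upperbound (cbox a b) = b"
  using assms by (auto simp: Basis_vec_def inner_axis intro!: interval_lowerbound interval_upperbound)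

text \<open>The edge vector of a subbox is independent of the selector \<open>e\<close>. Recording a
  corner and a multiple of \<open>b - a\<close> lets successive subdivisions compose and makes
  diameters scale in every norm.\<close>

lemma subboxes_scaled_translate:
  fixes a b :: "real^'d"
  assumes "\<forall>k. a $ k < b $ k" "Y \<in> subboxes m (cbox a b)"
  shows "\<exists>c. Y = cbox c (c + (1 / real m) *\<^sub>R (b - a))" and "Y \<subseteq> cbox a b"
proof -
  have le: "\<forall>k. a $ k \<le> b $ k" using assms(1) less_imp_le by blast
  obtain e :: "'d \<Rightarrow> nat" where e: "\<forall>k. e k < m"
    and Y: "Y = cbox (\<chi> k. a $ k + real (e k) / real m * (b $ k - a $ k))
            (\<chi> k. a $ k + real (e k + 1) / real m * (b $ k - a $ k))" (is "_ = cbox ?c ?c'")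
    using assms(2) le
    by (auto simp: subboxes_def Let_def interval_bounds_cart)
  have "?c' = ?c + (1 / real m) *\<^sub>R (b - a)"
    by (simp add: vec_eq_iff add_divide_distrib distrib_right diff_divide_distrib)
  then show "\<exists>c. Y = cbox c (c + (1 / real m) *\<^sub>R (b - a))"
    by (intro exI[of _ ?c]) (simp only: Y)
  have sub: "a $ k \<le> ?c $ k" "?c' $ k \<le> b $ k" for k
  proof -
    have "real (e k + 1) / real m \<le> 1"
      using e[rule_format, of k] by (simp add: field_simps)
    then have "real (e k + 1) / real m * (b $ k - a $ k) \<le> 1 * (b $ k - a $ k)"
      using le by (intro mult_right_mono) auto
    then show "a $ k \<le> ?c $ k" "?c' $ k \<le> b $ k" using le by simp_all
  qed
  show "Y \<subseteq> cbox a b"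
  proof
    fix x assume "x \<in> Y"
    then have "?c $ k \<le> x $ k" "x $ k \<le> ?c' $ k" for k
      unfolding Y mem_box_cart by blast+
    then show "x \<in> cbox a b"
      unfolding mem_box_cart using sub order_trans by blast
  qed
qed

lemma subboxes_cover:
  fixes a b :: "real^'d"
  assumes "\<forall>k. a $ k < b $ k" "m \<ge> 1" "x \<in> cbox a b"
  shows "\<exists>Y\<in>subboxes m (cbox a b). x \<in> Y"
proof -
  have le: "\<forall>k. a $ k \<le> b $ k" using assms(1) less_imp_le by blast
  define q where "q k = (x $ k - a $ k) / (b $ k - a $ k)" for k
  \<comment> \<open>The minimum matters on the upper faces, where \<open>q k = 1\<close> and the
    floor would select the nonexistent part number \<open>m\<close>.\<close>
  define e where "e k = min (m - 1) (nat \<lfloor>real m * q k\<rfloor>)" for k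
  have q: "0 \<le> q k" "q k \<le> 1" "x $ k = a $ k + q k * (b $ k - a $ k)" for k
    using assms(1,3) by (auto simp: q_def mem_box_cart divide_simps) (metis less_irrefl)+
  have e: "e k < m" "real (e k) / real m \<le> q k" "q k \<le> real (e k + 1) / real m" for k
  proof -
    have "0 \<le> real m * q k" "real m * q k \<le> real m"
      using q[of k] by (auto simp: mult_left_le)
    then have "real (e k) \<le> real m * q k \<and> real m * q k \<le> real (e k + 1)"
      using assms(2) by (simp add: e_def min_def) linarith
    then show "real (e k) / real m \<le> q k" "q k \<le> real (e k + 1) / real m"
      using assms(2) by (simp_all add: field_simps)
    show "e k < m" using assms(2) by (simp add: e_def)
  qed
  let ?Y = "cbox (\<chi> k. a $ k + real (e k) / real m * (b $ k - a $ k))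
            (\<chi> k. a $ k + real (e k + 1) / real m * (b $ k - a $ k))"
  have "?Y \<in> subboxes m (cbox a b)"
    using e(1) le
    by (auto simp: subboxes_def Let_def interval_bounds_cart)
  moreover have "x \<in> ?Y"
    unfolding mem_box_cart vec_lambda_beta
    using mult_right_mono[OF e(2)] mult_right_mono[OF e(3)] le q(3) by (simp del: of_nat_add)
  ultimately show ?thesis by blast
qed

text \<open>The map sending \<open>w\<close> to \<open>a + (1 / s) *\<^sub>R (w - c)\<close> carries
  the small box into \<open>cbox a b\<close>, and its translation part cancels in differences. Thus
  distances in the small box are controlled by the diameter of \<open>cbox a b\<close>.\<close>

lemma scaled_translate_difference:
  fixes a b :: "'a::euclidean_space"
  assumes "0 < s" "x \<in> cbox c (c + s *\<^sub>R (b - a))" "y \<in> cbox c (c + s *\<^sub>R (b - a))"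
  shows "\<exists>u\<in>cbox a b. \<exists>v\<in>cbox a b. x - y = s *\<^sub>R (u - v)"
proof -
  have mem: "a + (1 / s) *\<^sub>R (w - c) \<in> cbox a b" if "w \<in> cbox c (c + s *\<^sub>R (b - a))" for w
  proof -
    have "0 \<le> (w - c) \<bullet> i" "(w - c) \<bullet> i \<le> s * ((b - a) \<bullet> i)" if "i \<in> Basis" for i
      using \<open>w \<in> _\<close> that by (auto simp: mem_box inner_simps algebra_simps)
    then have "0 \<le> (w - c) \<bullet> i" "(w - c) \<bullet> i / s \<le> (b - a) \<bullet> i" if "i \<in> Basis" for i
      using that assms(1) by (simp_all add: pos_divide_le_eq mult.commute)
    then show ?thesis
      using assms(1) by (simp add: mem_box inner_add_left inner_diff_left add.commute le_diff_eq)
  qed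
  have "x - y = s *\<^sub>R ((a + (1 / s) *\<^sub>R (x - c)) - (a + (1 / s) *\<^sub>R (y - c)))"
    using assms(1) by (simp add: algebra_simps)
  then show ?thesis using mem assms(2,3) by blast
qed

lemma box_center_in_box:
  fixes a b :: "real^'d"
  assumes "\<forall>k. a $ k \<le> b $ k"
  shows "box_center (cbox a b) \<in> cbox a b"
  using assms unfolding box_center_def
  by (simp add: interval_bounds_cart mem_box_cart midpoint_def
      field_simps)

lemma cover_index_Suc:
  assumes "i' \<in> cover_index d (Suc n)"
  obtains i l where "i \<in> cover_index d n" "l < 2 ^ d" "i' = i * 2 ^ d + l"
proof
  show "i' div 2 ^ d \<in> cover_index d n"
    using assms by (auto simp: cover_index_def power_add mult.commute intro: less_mult_imp_div_less)
  show "i' mod 2 ^ d < 2 ^ d" "i' = (i' div 2 ^ d) * 2 ^ d + i' mod 2 ^ d"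
    by (simp_all only: div_mult_mod_eq) simp
qed

lemma cover_index_SucI:
  assumes "i \<in> cover_index d n" "l < 2 ^ d"
  shows "i * 2 ^ d + l \<in> cover_index d (Suc n)"
proof -
  have "i * 2 ^ d + l < (i + 1) * 2 ^ d" using assms(2) by simp
  also have "\<dots> \<le> 2 ^ (n * d) * 2 ^ d"
    using assms(1) by (intro mult_right_mono) (auto simp: cover_index_def)
  finally show ?thesis by (simp add: cover_index_def power_add mult.commute)
qed

lemma dyadic_covers_scaled_translate:
  fixes a b :: "real^'d"
  assumes "dyadic_covers (cbox a b) D" "\<forall>k. a $ k < b $ k" "i \<in> cover_index CARD('d) n"
  shows "\<exists>c. D n i = cbox c (c + (1 / 2 ^ n) *\<^sub>R (b - a))"
  using assms(3)
proof (induction n arbitrary: i)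
  case 0
  then have "D 0 i = cbox a (a + (1 / 2 ^ 0) *\<^sub>R (b - a))"
    using assms(1) by (simp add: cover_index_def dyadic_covers_def)
  then show ?case by blast
next
  case (Suc n)
  obtain j l where j: "j \<in> cover_index CARD('d) n" "l < 2 ^ CARD('d)"
      "i = j * 2 ^ CARD('d) + l"
    using cover_index_Suc[OF Suc.prems] .
  obtain c where c: "D n j = cbox c (c + (1 / 2 ^ n) *\<^sub>R (b - a))"
    using Suc.IH[OF j(1)] by blast
  have "D (Suc n) i \<in> subboxes 2 (D n j)"
    using assms(1) j unfolding dyadic_covers_def bij_betw_def by blast
  then show ?case
    using subboxes_scaled_translate(1)[of c "c + (1 / 2 ^ n) *\<^sub>R (b - a)" "D (Suc n) i" 2] assms(2)
    by (simp add: c)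
qed

text \<open>Descent through the levels: a box containing \<open>x\<close> has a half-size subbox
  containing \<open>x\<close>, and surjectivity of the numbering provides an index for it.\<close>

lemma dyadic_covers_cover:
  fixes a b :: "real^'d"
  assumes "dyadic_covers (cbox a b) D" "\<forall>k. a $ k < b $ k" "x \<in> cbox a b"
  shows "\<exists>i\<in>cover_index CARD('d) n. x \<in> D n i"
proof (induction n)
  case 0
  then show ?case using assms by (auto simp: cover_index_def dyadic_covers_def)
next
  case (Suc n)
  then obtain i where i: "i \<in> cover_index CARD('d) n" "x \<in> D n i" by blast
  obtain c where c: "D n i = cbox c (c + (1 / 2 ^ n) *\<^sub>R (b - a))"
    using dyadic_covers_scaled_translate[OF assms(1,2) i(1)] by blast
  obtain Y where Y: "Y \<in> subboxes 2 (D n i)" "x \<in> Y"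
    using subboxes_cover[of c "c + (1 / 2 ^ n) *\<^sub>R (b - a)" 2 x] assms(2) i(2)
    by (auto simp: c)
  then have "Y \<in> (\<lambda>l. D (Suc n) (i * 2 ^ CARD('d) + l)) ` {..<2 ^ CARD('d)}"
    using assms(1) i(1) unfolding dyadic_covers_def bij_betw_def by blast
  then show ?case using cover_index_SucI[OF i(1)] Y(2) by blast
qed

lemma cover_diam_eq: "cover_diam nrm Q n = enn2real (norm_diam nrm Q) / 2 ^ n"
  by (induction n) simp_all

lemma vector_norm_diff_le_scaled_diam:
  assumes "vector_norm nrm" "0 < s" "x \<in> cbox c (c + s *\<^sub>R (b - a))" "y \<in> cbox c (c + s *\<^sub>R (b - a))"
  shows "nrm (x - y) \<le> s * enn2real (norm_diam nrm (cbox a b))"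
proof -
  obtain u v where uv: "u \<in> cbox a b" "v \<in> cbox a b" "x - y = s *\<^sub>R (u - v)"
    using scaled_translate_difference[OF assms(2-4)] by blast
  show ?thesis
    unfolding uv(3) vector_norm_scaleR[OF assms(1)]
    using vector_norm_diff_le_diam[OF assms(1) bounded_cbox uv(1,2)] assms(2)
    by (simp add: mult_left_mono)
qed

section \<open>Convergence rates and the theorem\<close>

lemma tendsto_zero_ennreal_bound:
  fixes F :: "nat \<Rightarrow> ennreal"
  assumes "\<And>n. F n \<le> ennreal (f n)" "f \<longlonglongrightarrow> 0"
  shows "F \<longlonglongrightarrow> 0"
proof (rule tendsto_sandwich[OF _ _ tendsto_const])
  show "(\<lambda>n. ennreal (f n)) \<longlonglongrightarrow> 0"
    using tendsto_ennrealI[OF assms(2)] by simp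
qed (use assms(1) in auto)

theorem proposition16:
  fixes nrm :: "real^'d \<Rightarrow> real"
    and g :: "real^'d \<Rightarrow> real^'d"
    and \<phi> :: "real \<Rightarrow> real^'d \<Rightarrow> real^'d"
    and P L :: real
    and Q :: "(real^'d) set"
    and M N :: nat
    and D :: "nat \<Rightarrow> nat \<Rightarrow> (real^'d) set"
    and E :: "nat \<Rightarrow> nat \<Rightarrow> nat \<Rightarrow> (real^'d) set"
    and z :: "nat \<Rightarrow> nat \<Rightarrow> nat \<Rightarrow> real^'d"
    and I :: "nat \<Rightarrow> nat set"
    and \<rho> \<rho>' h r :: "nat \<Rightarrow> real"
    and \<Phi> :: "nat \<Rightarrow> nat \<Rightarrow> nat set"
  assumes "vector_norm nrm"
    and "\<forall>x. nrm (g x) \<le> P"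
    and "\<forall>x y. nrm (g x - g y) \<le> L * nrm (x - y)"
    and "solution_map g \<phi>"
    and "is_box Q"
    and "M \<ge> 1" and "N \<ge> 1"
    and "\<forall>n. I n = cover_index CARD('d) n"
    and "dyadic_covers Q D"
    and "box_decompositions M D E"
    and "\<forall>n. \<forall>i\<in>I n. \<forall>l<M ^ CARD('d). z n i l = box_center (E n i l)"
    and "\<forall>n. \<rho> n = cover_diam nrm Q n"
    and "\<forall>n. \<rho>' n = \<rho> n / real M"
    and "\<forall>n. h n > 0"
    and "h \<longlonglongrightarrow> 0"
    and "(\<lambda>n. inverse (h n) * \<rho> n) \<longlonglongrightarrow> 0"
    and "\<forall>n. r n = exp (L * h n) * \<rho>' n
                 + 1 / (2 * real N) * P * h n * (exp (L * h n) - 1)"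
    and "\<forall>n. \<forall>i\<in>I n. \<Phi> n i =
           {j \<in> I n. ((\<Union>l<M ^ CARD('d). {euler_backward g (h n / real N) N (z n i l)})
                        + norm_ball0 nrm (r n)) \<inter> D n j \<noteq> {}}"
  shows "((\<lambda>n. SUP i\<in>I n. SUP j\<in>\<Phi> n i. norm_semidist nrm (D n j) (D n i)) \<longlonglongrightarrow> 0)
       \<and> ((\<lambda>n. SUP i\<in>I n. SUP j\<in>\<Phi> n i. SUP x\<in>D n j. SUP y\<in>D n i.
               ennreal (nrm (inverse (h n) *\<^sub>R (x - y) + g y))) \<longlonglongrightarrow> 0)
       \<and> (\<forall>n. \<forall>i\<in>I n. (\<phi> (- h n) ` D n i) \<inter> Q \<subseteq> (\<Union>j\<in>\<Phi> n i. D n j))"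
proof -
  note nrm = assms(1)
  note bound = assms(2) and lipschitz = assms(3)
  note euler = bound_nonneg[OF nrm bound] lipschitz_constant_nonneg[OF nrm bound lipschitz]
  have I: "I n = cover_index CARD('d) n" for n using assms(8) by blast
  have h: "0 < h n" for n using assms(14) by blast
  obtain a b where ab: "\<forall>k. a $ k < b $ k" and Q: "Q = cbox a b"
    using assms(5) by (auto simp: is_box_def)
  have \<rho>: "\<rho> n = 1 / 2 ^ n * enn2real (norm_diam nrm (cbox a b))" for n
    using assms(12) by (simp add: cover_diam_eq Q)
  have D: "\<exists>c. D n i = cbox c (c + (1 / 2 ^ n) *\<^sub>R (b - a))" if "i \<in> I n" for n i
    using dyadic_covers_scaled_translate[OF _ ab] assms(9) that by (simp add: Q I)
  have diam_D: "nrm (x - y) \<le> \<rho> n" if i: "i \<in> I n" and "x \<in> D n i" "y \<in> D n i" for n i x y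
  proof -
    obtain c where "D n i = cbox c (c + (1 / 2 ^ n) *\<^sub>R (b - a))"
      using D[OF i] by blast
    then show ?thesis
      using vector_norm_diff_le_scaled_diam[OF nrm, of "1 / 2 ^ n"] that by (simp add: \<rho>)
  qed
  have z: "z n i l \<in> D n i" and z_dist: "x \<in> E n i l \<Longrightarrow> nrm (x - z n i l) \<le> \<rho>' n"
    if i: "i \<in> I n" and l: "l < M ^ CARD('d)" for n i l x
  proof -
    obtain c where c: "D n i = cbox c (c + (1 / 2 ^ n) *\<^sub>R (b - a))"
      using D[OF i] by blast
    have lt: "\<forall>k. c $ k < (c + (1 / 2 ^ n) *\<^sub>R (b - a)) $ k"
      using ab by simp
    have "E n i l \<in> subboxes M (D n i)"
      using assms(10) i l unfolding box_decompositions_def bij_betw_def I by blast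
    note E = this[unfolded c]
    obtain c' where c': "E n i l = cbox c' (c' + (1 / real M / 2 ^ n) *\<^sub>R (b - a))"
      using subboxes_scaled_translate(1)[OF lt E] by auto
    have "z n i l = box_center (E n i l)"
      using assms(11) i l by blast
    then have zE: "z n i l \<in> E n i l"
      unfolding c' using ab assms(6) by (auto intro!: box_center_in_box divide_nonneg_nonneg less_imp_le)
    then show "z n i l \<in> D n i"
      using subboxes_scaled_translate(2)[OF lt E] c by blast
    have "1 / real M / 2 ^ n > 0" using assms(6) by simp
    \<comment> \<open>The center is treated as just another point of the subbox, so the full
      diameter bounds the distance.\<close>
    then show "nrm (x - z n i l) \<le> \<rho>' n" if "x \<in> E n i l"
      using vector_norm_diff_le_scaled_diam[OF nrm _ that[unfolded c'] zE[unfolded c']] assms(13)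
      by (simp add: \<rho> mult.commute)
  qed
  \<comment> \<open>Unpacks the Minkowski sum: \<open>\<zeta>\<close> is a subbox center and
    \<open>w\<close> a point common to \<open>D n j\<close> and the ball of radius
    \<open>r n\<close> around its Euler image.\<close>
  have near: "\<exists>\<zeta>\<in>D n i. \<exists>w\<in>D n j. nrm (w - euler_backward g (h n / real N) N \<zeta>) \<le> r n"
    if i: "i \<in> I n" and j: "j \<in> \<Phi> n i" for n i j
  proof -
    have "((\<Union>l<M ^ CARD('d). {euler_backward g (h n / real N) N (z n i l)})
        + norm_ball0 nrm (r n)) \<inter> D n j \<noteq> {}"
      using assms(18) i j by blast
    then obtain l v where "l < M ^ CARD('d)" "nrm v \<le> r n"
        "euler_backward g (h n / real N) N (z n i l) + v \<in> D n j"
      by (auto simp: norm_ball0_def elim!: set_plus_elim)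
    then show ?thesis
      using z[OF i] by (intro bexI[of _ "z n i l"] bexI) auto
  qed
  have \<Phi>_I: "j \<in> I n" if "i \<in> I n" "j \<in> \<Phi> n i" for n i j
    using assms(18) that by blast
  have h_N: "0 \<le> h n / real N" "real N * (h n / real N) = h n" for n
    using h[of n] assms(7) by (auto simp: less_imp_le)

  have exp_lim: "(\<lambda>n. exp (L * h n)) \<longlonglongrightarrow> 1"
    using tendsto_exp[OF tendsto_mult_left[OF assms(15), of L]] by simp
  \<comment> \<open>After division by \<open>h n\<close>, the first term of \<open>r n\<close> is a
    bounded factor times \<open>\<rho> n / h n\<close>, and the second is a constant times
    \<open>exp (L * h n) - 1\<close>; both vanish.\<close>
  have r_h_lim: "(\<lambda>n. inverse (h n) * r n) \<longlonglongrightarrow> 0"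
  proof -
    have "(\<lambda>n. exp (L * h n) * (inverse (h n) * \<rho> n) / real M
        + 1 / (2 * real N) * P * (exp (L * h n) - 1))
        \<longlonglongrightarrow> 1 * 0 / real M + 1 / (2 * real N) * P * (1 - 1)"
      using assms(6) by (intro tendsto_intros exp_lim assms(16)) auto
    moreover have "inverse (h n) * r n = exp (L * h n) * (inverse (h n) * \<rho> n) / real M
        + 1 / (2 * real N) * P * (exp (L * h n) - 1)" for n
      using h[of n] assms(17,13) by (simp add: field_simps)
    ultimately show ?thesis by simp
  qed
  have lim_of_quotient: "f \<longlonglongrightarrow> 0" if "(\<lambda>n. inverse (h n) * f n) \<longlonglongrightarrow> 0" for f :: "nat \<Rightarrow> real"
  proof -
    have "h n * (inverse (h n) * f n) = f n" for n
      using h[of n] by simp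
    then show ?thesis using tendsto_mult[OF assms(15) that] by (simp only: mult_zero_left)
  qed
  note \<rho>_lim = lim_of_quotient[OF assms(16)] and r_lim = lim_of_quotient[OF r_h_lim]

  \<comment> \<open>The single point \<open>\<zeta>\<close> bounds the infimum for every
    \<open>x\<close>. The path from \<open>x\<close> via \<open>w\<close> and the Euler image to
    \<open>\<zeta>\<close> has legs of length at most \<open>\<rho> n\<close>, \<open>r n\<close>
    and \<open>P * h n\<close>.\<close>
  have semidist_le: "norm_semidist nrm (D n j) (D n i) \<le> ennreal (\<rho> n + r n + P * h n)"
    if i: "i \<in> I n" and j: "j \<in> \<Phi> n i" for n i j
  proof -
    let ?e = "euler_backward g (h n / real N) N"
    obtain \<zeta> w where \<zeta>: "\<zeta> \<in> D n i" and w: "w \<in> D n j" "nrm (w - ?e \<zeta>) \<le> r n"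
      using near[OF i j] by blast
    have "nrm (x - \<zeta>) \<le> \<rho> n + r n + P * h n" if "x \<in> D n j" for x
    proof -
      have "nrm (x - \<zeta>) \<le> nrm (x - w) + nrm (w - ?e \<zeta>) + nrm (?e \<zeta> - \<zeta>)"
        using vector_norm_triangle3[OF nrm, of "x - w" "w - ?e \<zeta>" "?e \<zeta> - \<zeta>"] by simp
      then show ?thesis
        using diam_D[OF \<Phi>_I[OF i j] that w(1)] w(2)
          euler_backward_displacement_le[OF nrm bound lipschitz h_N(1), of n N \<zeta>]
        unfolding h_N by linarith
    qed
    then show ?thesis
      unfolding norm_semidist_def using \<zeta> by (intro SUP_least INF_lower2[OF \<zeta>] ennreal_leI)
  qed
  have "(\<lambda>n. SUP i\<in>I n. SUP j\<in>\<Phi> n i. norm_semidist nrm (D n j) (D n i)) \<longlonglongrightarrow> 0"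
  proof (rule tendsto_zero_ennreal_bound)
    show "(\<lambda>n. \<rho> n + r n + P * h n) \<longlonglongrightarrow> 0"
      using tendsto_add[OF tendsto_add[OF \<rho>_lim r_lim] tendsto_mult_left[OF assms(15), of P]]
      by simp
  qed (intro SUP_least semidist_le)
  moreover
  \<comment> \<open>The sum of the five error terms below, divided by \<open>h n\<close>; the two
    copies of \<open>\<rho> n\<close> come from \<open>x - w\<close> and
    \<open>\<zeta> - y\<close>.\<close>
  define \<delta> where "\<delta> n = 2 * (inverse (h n) * \<rho> n) + inverse (h n) * r n + L * P * h n + L * \<rho> n" for n
  have "nrm (inverse (h n) *\<^sub>R (x - y) + g y) \<le> \<delta> n"
    if i: "i \<in> I n" and j: "j \<in> \<Phi> n i" and x: "x \<in> D n j" and y: "y \<in> D n i" for n i j x y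
  proof -
    let ?e = "euler_backward g (h n / real N) N"
    obtain \<zeta> w where \<zeta>: "\<zeta> \<in> D n i" and w: "w \<in> D n j" "nrm (w - ?e \<zeta>) \<le> r n"
      using near[OF i j] by blast
    \<comment> \<open>The consistency estimate is available at the starting point
      \<open>\<zeta>\<close> of the Euler scheme, so \<open>g \<zeta>\<close> enters first and the
      last summand corrects it to \<open>g y\<close>.\<close>
    have "x - y + h n *\<^sub>R g y
        = ((x - w) + (w - ?e \<zeta>) + (?e \<zeta> - \<zeta> + h n *\<^sub>R g \<zeta>) + (\<zeta> - y)) + h n *\<^sub>R (g y - g \<zeta>)"
      by (simp add: algebra_simps)
    also have "nrm \<dots> \<le> nrm (x - w) + nrm (w - ?e \<zeta>) + nrm (?e \<zeta> - \<zeta> + h n *\<^sub>R g \<zeta>) + nrm (\<zeta> - y)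
        + h n * nrm (g y - g \<zeta>)"
      by (rule order_trans[OF vector_norm_triangle[OF nrm] add_mono[OF vector_norm_triangle4[OF nrm]]])
        (simp add: vector_norm_scaleR[OF nrm] h less_imp_le)
    also have "\<dots> \<le> \<rho> n + r n + L * P * (h n)\<^sup>2 + \<rho> n + h n * (L * \<rho> n)"
    proof (intro add_mono)
      show "nrm (?e \<zeta> - \<zeta> + h n *\<^sub>R g \<zeta>) \<le> L * P * (h n)\<^sup>2"
        using euler_backward_consistency[OF nrm bound lipschitz h_N(1), of n N \<zeta>]
        unfolding h_N .
      have "nrm (g y - g \<zeta>) \<le> L * nrm (y - \<zeta>)"
        using lipschitz by blast
      also have "\<dots> \<le> L * \<rho> n"
        using diam_D[OF i y \<zeta>] euler(2) by (rule mult_left_mono)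
      finally show "h n * nrm (g y - g \<zeta>) \<le> h n * (L * \<rho> n)"
        using h[of n] by simp
    qed (use diam_D i \<Phi>_I[OF i j] x y \<zeta> w in auto)
    also have "\<dots> = h n * \<delta> n"
      using h[of n] by (simp add: \<delta>_def field_simps power2_eq_square)
    finally have "nrm (x - y + h n *\<^sub>R g y) \<le> h n * \<delta> n" .
    then have "inverse (h n) * nrm (x - y + h n *\<^sub>R g y) \<le> \<delta> n"
      using h[of n] by (simp add: field_simps)
    moreover have "inverse (h n) *\<^sub>R (x - y) + g y = inverse (h n) *\<^sub>R (x - y + h n *\<^sub>R g y)"
      using h[of n] by (simp add: scaleR_right_distrib)
    ultimately show ?thesis
      using h[of n] by (simp add: vector_norm_scaleR[OF nrm])
  qed
  then have "(\<lambda>n. SUP i\<in>I n. SUP j\<in>\<Phi> n i. SUP x\<in>D n j. SUP y\<in>D n i.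
      ennreal (nrm (inverse (h n) *\<^sub>R (x - y) + g y))) \<longlonglongrightarrow> 0"
  proof (intro tendsto_zero_ennreal_bound[where f = \<delta>] SUP_least ennreal_leI)
    have "\<delta> \<longlonglongrightarrow> 2 * 0 + 0 + L * P * 0 + L * 0"
      unfolding \<delta>_def by (intro tendsto_intros assms(15,16) r_h_lim \<rho>_lim)
    then show "\<delta> \<longlonglongrightarrow> 0" by simp
  qed
  \<comment> \<open>Here \<open>j\<close> indexes a box containing the image point \<open>y\<close>
    and \<open>l\<close> a subbox containing its preimage \<open>x\<close>. By the Euler error
    bound, \<open>y\<close> itself lies in both the inflated set and \<open>D n j\<close>.\<close>
  moreover have "(\<phi> (- h n) ` D n i) \<inter> Q \<subseteq> (\<Union>j\<in>\<Phi> n i. D n j)" if i: "i \<in> I n" for n i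
  proof
    fix y assume "y \<in> (\<phi> (- h n) ` D n i) \<inter> Q"
    then obtain x where x: "x \<in> D n i" and y: "y = \<phi> (- h n) x" "y \<in> Q" by blast
    obtain j where j: "j \<in> I n" "y \<in> D n j"
      using dyadic_covers_cover[OF _ ab] assms(9) y(2) unfolding Q I by blast
    obtain c where c: "D n i = cbox c (c + (1 / 2 ^ n) *\<^sub>R (b - a))"
      using D[OF i] by blast
    obtain Y where Y: "Y \<in> subboxes M (D n i)" "x \<in> Y"
      using subboxes_cover[of c "c + (1 / 2 ^ n) *\<^sub>R (b - a)" M x] ab assms(6) x
      by (auto simp: c)
    then have "Y \<in> E n i ` {..<M ^ CARD('d)}"
      using assms(10) i unfolding box_decompositions_def bij_betw_def I by blast
    then obtain l where l: "l < M ^ CARD('d)" "x \<in> E n i l"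
      using Y(2) by blast
    let ?e = "euler_backward g (h n / real N) N (z n i l)"
    have "nrm (y - ?e) \<le> exp (L * h n) * nrm (x - z n i l)
        + 1 / (2 * real N) * P * h n * (exp (L * h n) - 1)"
      unfolding y(1)
      using euler_backward_error_exp[OF nrm bound lipschitz assms(4) less_imp_le[OF h] assms(7)] .
    also have "\<dots> \<le> r n"
      using z_dist[OF i l] assms(17) by simp
    finally have "?e + (y - ?e) \<in> (\<Union>l<M ^ CARD('d). {euler_backward g (h n / real N) N (z n i l)})
        + norm_ball0 nrm (r n)"
      using l(1) by (intro set_plus_intro) (auto simp: norm_ball0_def)
    then have "j \<in> \<Phi> n i"
      using assms(18) i j by auto
    then show "y \<in> (\<Union>j\<in>\<Phi> n i. D n j)" using j(2) by blast
  qed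
  ultimately show ?thesis by blast
qed

end
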